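(* Let $f_h^n\in V_h^k(\mathcal{E})$ be the numerical solution at time $t^n$ and let $f_h^{n+1}=\mathcal{S}^h_{\mathbf{E}}(\Delta t)\,\mathcal{S}^h_{\mathbf{f}}(\Delta t) f_h^n$ be the result of one step of the AP-CSLDG-1 scheme with time step $\Delta t>0$ (defined in the context). Then the scheme preserves the global mass: $$\int_{\Omega_v}\int_{\Omega_x} f_h^{n+1}(x,v)\,\mathrm{d}x\,\mathrm{d}v=\int_{\Omega_v}\int_{\Omega_x} f_h^{n}(x,v)\,\mathrm{d}x\,\mathrm{d}v .$$
   Context: Mesh and space. $\Omega_x=[x_L,x_R]$ and $\Omega_v=[v_{\min},v_{\max}]$ are partitioned uniformly into cells $I_{x_j}=[x_{j-1/2},x_{j+1/2}]$, $j=1,\dots,N_x$, and $I_{v_i}=[v_{i-1/2},v_{i+1/2}]$, $i=1,\dots,N_v$. Functions are extended periodically in $x$ and in $v$. For an integer $k\ge 0$, $\mathcal{D}_k(\mathcal{E}_x)$ (resp. $\mathcal{D}_k(\mathcal{E}_v)$) is the space of functions whose restriction to each $I_{x_j}$ (resp. $I_{v_i}$) is a polynomial of degree at most $k$, and $V_h^k(\mathcal{E})=\mathcal{D}_k(\mathcal{E}_x)\otimes\mathcal{D}_k(\mathcal{E}_v)$. Let $\{x_{j,q}\}_{q=1}^{k+1}$ and $\{v_{i,p}\}_{p=1}^{k+1}$ be the $k+1$ Gauss(-Legendre) quadrature points of $I_{x_j}$ and $I_{v_i}$. An element of $V_h^k(\mathcal{E})$ is determined by its values on the lines $v=v_{i,p}$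 (all $i,p$), and also by its values on the lines $x=x_{j,q}$ (all $j,q$). Operator $\mathcal{S}^h_{\mathbf{f}}(\Delta t)$. $f_h^*=\mathcal{S}^h_{\mathbf{f}}(\Delta t)f_h^n\in V_h^k(\mathcal{E})$ is defined by: for every $i,p$ and $j$, and every $\Psi\in\mathcal{D}_k(\mathcal{E}_x)$, $$\int_{I_{x_j}} f_h^*(x,v_{i,p})\Psi(x)\,\mathrm{d}x=\int_{I_{x_j}^*} f_h^n(x,v_{i,p})\,\psi^n(x)\,\mathrm{d}x,$$ where $I_{x_j}^*=[x_{j-1/2}-v_{i,p}\Delta t,\;x_{j+1/2}-v_{i,p}\Delta t]$ and $\psi^n(x)=\Psi|_{I_{x_j}}(x+v_{i,p}\Delta t)$ for $x\in I_{x_j}^*$. Operator $\mathcal{S}^h_{\mathbf{E}}(\Delta t)$. First, real numbers $E_{j,q}=\partial_x\phi^{n+1}(x_{j,q})$ are computed, where $\phi^{n+1}$ is a numerical (Fourier spectral, then piecewise polynomially interpolated) solution of $$-\partial_x\left[(\lambda^2+\rho^n\Delta t^2)\partial_x\phi^{n+1}\right]=-\Delta t^2\partial_{xx}S^n+\Delta t\,\partial_x(\rho u)^n-\rho^n+1,$$ with $\rho^n,(\rho u)^n,S^n$ the velocity moments $\int_{\Omega_v}(1,v,v^2)f\,\mathrm{d}v$ of the numerical solution and $\lambda$ the dimensionless Debye length. Then $f_h^{n+1}=\mathcal{S}^h_{\mathbf{E}}(\Delta t)f_h^*\in V_h^k(\mathcal{E})$ is defined by: for every $j,q$ and $i$,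 and every $\Psi\in\mathcal{D}_k(\mathcal{E}_v)$, $$\int_{I_{v_i}} f_h^{n+1}(x_{j,q},v)\Psi(v)\,\mathrm{d}v=\int_{I_{v_i}^*} f_h^*(x_{j,q},v)\,\psi^n(v)\,\mathrm{d}v,$$ where $I_{v_i}^*=[v_{i-1/2}-E_{j,q}\Delta t,\;v_{i+1/2}-E_{j,q}\Delta t]$ and $\psi^n(v)=\Psi|_{I_{v_i}}(v+E_{j,q}\Delta t)$ for $v\in I_{v_i}^*$. Limiter. At the end of each of the two updates a positivity-preserving scaling limiter is applied: on each rectangular cell $K=I_{x_j}\times I_{v_i}$ the polynomial $g=f_h|_K$ is replaced by $\theta_K(g-\bar g_K)+\bar g_K$, where $\bar g_K$ is the average of $g$ over $K$, $\theta_K=\min\{|(m_0-\bar g_K)/(m_K'-\bar g_K)|,1\}$, $m_0=10^{-15}$, $m_K'=\min_K g$ (and $\theta_K=1$ if $g$ is constant on $K$). *)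

theory Defs
  imports "HOL-Analysis.Analysis" "HOL-Computational_Algebra.Polynomial"
begin

record grid =
  lo :: real
  hi :: real
  ncells :: nat

definition grid_ok :: "grid \<Rightarrow> bool" where
  "grid_ok G \<longleftrightarrow> lo G < hi G \<and> 1 \<le> ncells G"

definition width :: "grid \<Rightarrow> real" where
  "width G = (hi G - lo G) / real (ncells G)"

text \<open>The interface $x_{j+1/2}$, so that $x_{1/2}$ is the left end of the domain. The cells of the
  domain are those with index $1,\dots,N$; other integers index the cells of the periodically
  extended mesh.\<close>

definition iface :: "grid \<Rightarrow> int \<Rightarrow> real" where
  "iface G j = lo G + of_int j * width G"

text \<open>Discontinuous piecewise polynomials have two traces at an interface. To obtain single-valued
  functions on the whole line we attach each interface to the cell on its right; integrals do not
  see this choice.\<close>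

definition cell :: "grid \<Rightarrow> int \<Rightarrow> real set" where
  "cell G j = {iface G (j - 1)..<iface G j}"

definition cell_index :: "grid \<Rightarrow> real \<Rightarrow> int" where
  "cell_index G x = \<lfloor>(x - lo G) / width G\<rfloor> + 1"

definition DG :: "nat \<Rightarrow> grid \<Rightarrow> (real \<Rightarrow> real) set" where
  "DG k G = {g. (\<forall>x. g (x + (hi G - lo G)) = g x) \<and>
     (\<forall>j\<in>{1..int (ncells G)}. \<exists>p. degree p \<le> k \<and> (\<forall>x\<in>cell G j. g x = poly p x))}"

text \<open>The tensor product of the two spaces: finite sums of products.\<close>

definition DG2 :: "nat \<Rightarrow> grid \<Rightarrow> grid \<Rightarrow> (real \<Rightarrow> real \<Rightarrow> real) set" where
  "DG2 k X V = {f. \<exists>(n::nat) a b. (\<forall>m<n. a m \<in> DG k X \<and> b m \<in> DG k V) \<and>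
     f = (\<lambda>x v. \<Sum>m<n. a m x * b m v)}"

text \<open>Rodrigues' formula.\<close>

definition legendre :: "nat \<Rightarrow> real poly" where
  "legendre n = smult (1 / (2 ^ n * fact n)) ((pderiv ^^ n) ([:-1, 0, 1:] ^ n))"

text \<open>The $q$-th point ($q = 1,\dots,k+1$, in increasing order) of the $(k+1)$-point rule on
  $[-1,1]$.\<close>

definition gauss_node :: "nat \<Rightarrow> nat \<Rightarrow> real" where
  "gauss_node k q = sorted_list_of_set {x. poly (legendre (k + 1)) x = 0} ! (q - 1)"

definition gauss_point :: "grid \<Rightarrow> nat \<Rightarrow> int \<Rightarrow> nat \<Rightarrow> real" where
  "gauss_point G k j q =
     (iface G (j - 1) + iface G j) / 2 + width G / 2 * gauss_node k q"

text \<open>\<^term>\<open>is_Sf X V k dt f g\<close> and \<^term>\<open>is_SE X V k dt E f g\<close> are the defining equations of the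
  images \<^term>\<open>g\<close> of \<^term>\<open>f\<close> under the operators $\mathcal{S}^h_{\mathbf f}(\Delta t)$ and
  $\mathcal{S}^h_{\mathbf E}(\Delta t)$, before the limiter.\<close>

definition is_Sf ::
  "grid \<Rightarrow> grid \<Rightarrow> nat \<Rightarrow> real \<Rightarrow> (real \<Rightarrow> real \<Rightarrow> real) \<Rightarrow> (real \<Rightarrow> real \<Rightarrow> real) \<Rightarrow> bool" where
  "is_Sf X V k dt f g \<longleftrightarrow> g \<in> DG2 k X V \<and>
     (\<forall>i\<in>{1..int (ncells V)}. \<forall>p\<in>{1..k+1}. \<forall>j\<in>{1..int (ncells X)}. \<forall>\<Psi>\<in>DG k X.
        let v = gauss_point V k i p in
          integral {iface X (j - 1)..iface X j} (\<lambda>x. g x v * \<Psi> x) =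
          integral {iface X (j - 1) - v * dt..iface X j - v * dt} (\<lambda>x. f x v * \<Psi> (x + v * dt)))"

definition is_SE ::
  "grid \<Rightarrow> grid \<Rightarrow> nat \<Rightarrow> real \<Rightarrow> (int \<Rightarrow> nat \<Rightarrow> real) \<Rightarrow>
     (real \<Rightarrow> real \<Rightarrow> real) \<Rightarrow> (real \<Rightarrow> real \<Rightarrow> real) \<Rightarrow> bool" where
  "is_SE X V k dt E f g \<longleftrightarrow> g \<in> DG2 k X V \<and>
     (\<forall>j\<in>{1..int (ncells X)}. \<forall>q\<in>{1..k+1}. \<forall>i\<in>{1..int (ncells V)}. \<forall>\<Psi>\<in>DG k V.
        let x = gauss_point X k j q in
          integral {iface V (i - 1)..iface V i} (\<lambda>v. g x v * \<Psi> v) =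
          integral {iface V (i - 1) - E j q * dt..iface V i - E j q * dt}
            (\<lambda>v. f x v * \<Psi> (v + E j q * dt)))"

definition moment :: "grid \<Rightarrow> nat \<Rightarrow> (real \<Rightarrow> real \<Rightarrow> real) \<Rightarrow> real \<Rightarrow> real" where
  "moment V r f x = integral {lo V..hi V} (\<lambda>v. v ^ r * f x v)"

text \<open>A numerical solver for the reformulated Poisson equation
  $$-\partial_x[(\lambda^2+\rho\,\Delta t^2)\,\partial_x\phi]
     = -\Delta t^2\,\partial_{xx}S+\Delta t\,\partial_x(\rho u)-\rho+1 .$$
  It maps $\lambda$, $\Delta t$, $\rho$, $\rho u$ and $S$ to the (interpolated) discrete potential
  $\phi$. The discretisation and the interpolation are left open: a solver is any such map.\<close>

type_synonym field_solver =
  "real \<Rightarrow> real \<Rightarrow> (real \<Rightarrow> real) \<Rightarrow> (real \<Rightarrow> real) \<Rightarrow> (real \<Rightarrow> real) \<Rightarrow> (real \<Rightarrow> real)"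

definition potential ::
  "field_solver \<Rightarrow> real \<Rightarrow> grid \<Rightarrow> real \<Rightarrow> (real \<Rightarrow> real \<Rightarrow> real) \<Rightarrow> real \<Rightarrow> real" where
  "potential solver lambda V dt f = solver lambda dt (moment V 0 f) (moment V 1 f) (moment V 2 f)"

definition efield ::
  "field_solver \<Rightarrow> real \<Rightarrow> grid \<Rightarrow> grid \<Rightarrow> nat \<Rightarrow> real \<Rightarrow> (real \<Rightarrow> real \<Rightarrow> real) \<Rightarrow>
     int \<Rightarrow> nat \<Rightarrow> real" where
  "efield solver lambda X V k dt f j q =
     deriv (potential solver lambda V dt f) (gauss_point X k j q)"

definition cell_average :: "grid \<Rightarrow> grid \<Rightarrow> (real \<Rightarrow> real \<Rightarrow> real) \<Rightarrow> int \<Rightarrow> int \<Rightarrow> real" where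
  "cell_average X V f j i =
     integral {iface V (i - 1)..iface V i}
       (\<lambda>v. integral {iface X (j - 1)..iface X j} (\<lambda>x. f x v)) / (width X * width V)"

text \<open>For \<^term>\<open>f\<close> in \<^term>\<open>DG2 k X V\<close> the infimum over the half-open cell is the minimum of the
  polynomial on the closed cell.\<close>

definition cell_min :: "grid \<Rightarrow> grid \<Rightarrow> (real \<Rightarrow> real \<Rightarrow> real) \<Rightarrow> int \<Rightarrow> int \<Rightarrow> real" where
  "cell_min X V f j i = (INF (x, v)\<in>cell X j \<times> cell V i. f x v)"

definition limiter_theta :: "grid \<Rightarrow> grid \<Rightarrow> (real \<Rightarrow> real \<Rightarrow> real) \<Rightarrow> int \<Rightarrow> int \<Rightarrow> real" where
  "limiter_theta X V f j i =
     (if (\<lambda>(x, v). f x v) constant_on (cell X j \<times> cell V i) then 1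
      else min \<bar>(1 / 10 ^ 15 - cell_average X V f j i) /
                 (cell_min X V f j i - cell_average X V f j i)\<bar> 1)"

definition limiter ::
  "grid \<Rightarrow> grid \<Rightarrow> (real \<Rightarrow> real \<Rightarrow> real) \<Rightarrow> (real \<Rightarrow> real \<Rightarrow> real)" where
  "limiter X V f = (\<lambda>x v.
     let j = cell_index X x; i = cell_index V v; m = cell_average X V f j i
     in limiter_theta X V f j i * (f x v - m) + m)"

text \<open>The flag selects whether the limiter is applied at the end of each of the two updates
  (the scheme as run) or not (the bare composition of the two operators). The field is computed
  from the moments at the old time level.\<close>

definition ap_csldg1_step ::
  "bool \<Rightarrow> field_solver \<Rightarrow> real \<Rightarrow> grid \<Rightarrow> grid \<Rightarrow> nat \<Rightarrow> real \<Rightarrow>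
     (real \<Rightarrow> real \<Rightarrow> real) \<Rightarrow> (real \<Rightarrow> real \<Rightarrow> real) \<Rightarrow> bool" where
  "ap_csldg1_step limited solver lambda X V k dt f f' \<longleftrightarrow>
     (let post = (if limited then limiter X V else id) in
        \<exists>g h. is_Sf X V k dt f g \<and>
              is_SE X V k dt (efield solver lambda X V k dt f) (post g) h \<and>
              f' = post h)"

definition mass :: "grid \<Rightarrow> grid \<Rightarrow> (real \<Rightarrow> real \<Rightarrow> real) \<Rightarrow> real" where
  "mass X V f = integral {lo V..hi V} (\<lambda>v. integral {lo X..hi X} (\<lambda>x. f x v))"

end

theory Submission
  imports Defs
begin

text \<open>Testing an update with $\Psi = 1$ and summing over the cells, periodicity shows that the line
  integrals of the solution along the transport direction agree before and after, at every Gauss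
  node of the transverse variable. As functions of that variable these line integrals are piecewise
  polynomials of degree at most $k$, and $k+1$ distinct interior nodes per cell determine them.
  The limiter contracts towards the cell average, so it keeps the mass of each cell; it stays in
  the tensor product space because its coefficients are periodic in the cell indices.\<close>

section \<open>Gauss nodes\<close>

text \<open>Induction that removes the largest point: the mean value theorem on the gap between the
  two largest points gives a root of the derivative to the right of those found before. Keeping the
  roots strictly between minimum and maximum makes the new one distinct from them.\<close>

lemma poly_rolle_card:
  fixes p :: "real poly"
  assumes "finite S" "card S = Suc n" "\<And>x. x \<in> S \<Longrightarrow> poly p x = 0"
  shows "\<exists>T. finite T \<and> card T = n \<and> T \<subseteq> {Min S<..<Max S} \<and> (\<forall>x\<in>T. poly (pderiv p) x = 0)"
  using assms
proof (induction n arbitrary: S)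
  case 0
  then show ?case by (intro exI[of _ "{}"]) auto
next
  case (Suc n)
  define M where "M = Max S"
  define S' where "S' = S - {M}"
  have "S \<noteq> {}" using Suc.prems(2) by auto
  hence M: "M \<in> S" using Suc.prems(1) by (simp add: M_def)
  have S': "finite S'" "card S' = Suc n" using Suc.prems M by (auto simp: S'_def)
  hence ne: "S' \<noteq> {}" by auto
  obtain T where T: "finite T" "card T = n" "T \<subseteq> {Min S'<..<Max S'}"
    "\<forall>x\<in>T. poly (pderiv p) x = 0"
    using Suc.IH[OF S'] Suc.prems(3) S'_def by auto
  have maxS': "Max S' \<in> S'" using S' ne by auto
  have lt: "Max S' < M"
  proof -
    have "Max S' \<in> S" "Max S' \<noteq> M" using maxS' by (auto simp: S'_def)
    thus ?thesis using Suc.prems(1) Max_ge[of S "Max S'"] unfolding M_def by linarith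
  qed
  obtain t where t: "Max S' < t" "t < M" "poly p M - poly p (Max S') = (M - Max S') * poly (pderiv p) t"
    using poly_MVT[OF lt] by blast
  have root: "poly (pderiv p) t = 0"
    using t maxS' M lt Suc.prems(3) by (auto simp: S'_def)
  have min: "Min S \<le> Min S'" using Suc.prems(1) ne by (intro Min_antimono) (auto simp: S'_def)
  have "Min S' \<le> Max S'" using S' ne by simp
  moreover have "t \<notin> T" using T t by auto
  ultimately show ?case
    using T t root min lt
    by (intro exI[of _ "insert t T"]) (auto simp: M_def[symmetric])
qed

text \<open>By the product rule each differentiation costs at most one factor
  \<open>q\<close>.\<close>

lemma pderiv_iterate_power_dvd:
  fixes q :: "real poly"
  shows "m \<le> n \<Longrightarrow> q ^ (n - m) dvd (pderiv ^^ m) (q ^ n)"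
proof (induction m)
  case 0
  then show ?case by simp
next
  case (Suc m)
  then obtain r where r: "(pderiv ^^ m) (q ^ n) = q ^ (n - m) * r"
    by (auto elim: dvdE)
  obtain l where l: "n - m = Suc l" "n - Suc m = l"
    using Suc.prems by (metis Suc_diff_Suc Suc_le_lessD)
  have "(pderiv ^^ Suc m) (q ^ n) = pderiv (q ^ Suc l * r)" using r l by simp
  also have "\<dots> = q ^ l * (q * pderiv r + smult (of_nat (Suc l)) (pderiv q) * r)"
    unfolding pderiv_mult pderiv_power_Suc by (simp add: algebra_simps)
  finally show ?case using l by simp
qed

text \<open>Rolle's theorem gains a root at each differentiation, since $\pm 1$ remain roots as long as fewer
  than $n$ derivatives have been taken.\<close>

lemma legendre_roots_interior:
  "m \<le> n \<Longrightarrow> \<exists>S\<subseteq>{-1<..<1::real}. finite S \<and> card S = m \<and>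
     (\<forall>x\<in>S. poly ((pderiv ^^ m) ([:-1, 0, 1:] ^ n)) x = 0)"
proof (induction m)
  case 0
  then show ?case by (intro exI[of _ "{}"]) auto
next
  case (Suc m)
  let ?p = "(pderiv ^^ m) ([:-1, 0, 1::real:] ^ n)"
  obtain S where S: "S \<subseteq> {-1<..<1}" "finite S" "card S = m" "\<forall>x\<in>S. poly ?p x = 0"
    using Suc by auto
  have "[:-1, 0, 1::real:] ^ (n - m) dvd ?p" using Suc.prems by (intro pderiv_iterate_power_dvd) auto
  moreover have "[:-1, 0, 1::real:] dvd [:-1, 0, 1:] ^ (n - m)" using Suc.prems by (simp add: dvd_power)
  ultimately have "[:-1, 0, 1::real:] dvd ?p" by (rule dvd_trans[rotated])
  then obtain r where r: "?p = [:-1, 0, 1::real:] * r" by (elim dvdE)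
  have ends: "poly ?p 1 = 0" "poly ?p (-1) = 0" by (simp_all add: r)
  \<comment> \<open>With both endpoints adjoined there are \<open>m + 2\<close> roots, so Rolle
    yields \<open>m + 1\<close> roots of the next derivative.\<close>
  let ?S = "insert (-1) (insert 1 S)"
  have card: "card ?S = Suc (Suc m)" 
  proof -
    have "-1 \<notin> insert 1 S" "1 \<notin> S" using S(1) by auto
    thus ?thesis using S(2,3) by simp
  qed
  obtain T where T: "finite T" "card T = Suc m" "T \<subseteq> {Min ?S<..<Max ?S}"
      "\<forall>x\<in>T. poly (pderiv ?p) x = 0"
    using poly_rolle_card[of ?S "Suc m" ?p] card S ends by auto
  have "Min ?S \<in> ?S" "Max ?S \<in> ?S" using S(2) by (intro Min_in Max_in; simp)+
  moreover have "?S \<subseteq> {-1..1}" using S(1) by force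
  ultimately have "-1 \<le> Min ?S" "Max ?S \<le> 1" by (meson atLeastAtMost_iff subsetD)+
  hence "{Min ?S<..<Max ?S} \<subseteq> {-1<..<1}" by auto
  then show ?case using T by (intro exI[of _ T]) auto
qed

lemma degree_pderiv_iterate: "degree ((pderiv ^^ m) (p :: real poly)) = degree p - m"
  by (induction m) (auto simp: degree_pderiv)

lemma degree_legendre: "degree (legendre n) = n"
  by (simp add: legendre_def degree_pderiv_iterate degree_power_eq)

text \<open>The \<open>n\<close> interior roots obtained from Rodrigues' formula already exhaust the
  roots of a nonzero polynomial of degree \<open>n\<close>.\<close>

lemma legendre_roots:
  assumes "n > 0"
  shows "finite {x. poly (legendre n) x = 0}" "card {x. poly (legendre n) x = 0} = n"
    "{x. poly (legendre n) x = 0} \<subseteq> {-1<..<1}"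
proof -
  have nz: "legendre n \<noteq> 0" using degree_legendre[of n] assms by auto
  show fin: "finite {x. poly (legendre n) x = 0}" using nz by (rule poly_roots_finite)
  obtain S where S: "S \<subseteq> {-1<..<1}" "card S = n" "S \<subseteq> {x. poly (legendre n) x = 0}"
    using legendre_roots_interior[of n n] by (auto simp: legendre_def)
  have "card {x. poly (legendre n) x = 0} \<le> card S"
    using card_poly_roots_bound[OF nz] S by (simp add: degree_legendre)
  hence "S = {x. poly (legendre n) x = 0}" using fin S by (metis card_seteq)
  with S show "card {x. poly (legendre n) x = 0} = n" "{x. poly (legendre n) x = 0} \<subseteq> {-1<..<1}" by auto
qed

text \<open>The root list has exactly \<open>k + 1\<close> entries, so the index
  \<open>q - 1\<close> is in range and the node is a genuine root.\<close>

lemma gauss_node_bounds: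
  assumes "q \<in> {1..k+1}"
  shows "gauss_node k q \<in> {-1<..<1}"
proof -
  let ?R = "{x. poly (legendre (k+1)) x = 0}"
  have R: "finite ?R" "card ?R = k+1" "?R \<subseteq> {-1<..<1}" using legendre_roots[of "k+1"] by auto
  have "gauss_node k q \<in> set (sorted_list_of_set ?R)"
    unfolding gauss_node_def using assms R by (intro nth_mem) auto
  thus ?thesis using R by auto
qed

lemma inj_on_gauss_node: "inj_on (gauss_node k) {1..k+1}"
proof -
  let ?R = "{x. poly (legendre (k+1)) x = 0}"
  have R: "finite ?R" "card ?R = k+1" using legendre_roots[of "k+1"] by auto
  show ?thesis unfolding gauss_node_def using R
    by (intro inj_onI) (auto simp: nth_eq_iff_index_eq)
qed

section \<open>Meshes and periodic functions\<close>

lemma width_pos: "grid_ok G \<Longrightarrow> width G > 0"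
  by (auto simp: grid_ok_def width_def)

lemma ncells_width: "grid_ok G \<Longrightarrow> real (ncells G) * width G = hi G - lo G"
  by (auto simp: grid_ok_def width_def)

lemma iface_0 [simp]: "iface G 0 = lo G"
  by (simp add: iface_def)

lemma iface_ncells: "grid_ok G \<Longrightarrow> iface G (int (ncells G)) = hi G"
  using ncells_width[of G] by (simp add: iface_def)

lemma iface_diff: "iface G j - iface G (j - 1) = width G"
  by (simp add: iface_def algebra_simps)

lemma iface_less: "grid_ok G \<Longrightarrow> iface G (j - 1) < iface G j"
  using iface_diff[of G j] width_pos[of G] by linarith

lemma iface_period: "grid_ok G \<Longrightarrow> iface G (j + int (ncells G)) = iface G j + (hi G - lo G)"
  using ncells_width[of G] by (simp add: iface_def algebra_simps)

lemma cell_period: "grid_ok G \<Longrightarrow> x \<in> cell G (j + int (ncells G)) \<longleftrightarrow> x - (hi G - lo G) \<in> cell G j"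
  using iface_period[of G j] iface_period[of G "j - 1"]
  by (auto simp: cell_def algebra_simps)

text \<open>The half-open cells tile the line, and after rescaling by the width the floor function
  selects the tile.\<close>

lemma mem_cell_iff: "grid_ok G \<Longrightarrow> x \<in> cell G j \<longleftrightarrow> cell_index G x = j"
proof -
  assume G: "grid_ok G"
  have w: "width G > 0" by (rule width_pos[OF G])
  have "cell_index G x = j \<longleftrightarrow>
      of_int (j - 1) \<le> (x - lo G) / width G \<and> (x - lo G) / width G < of_int (j - 1) + 1"
    unfolding cell_index_def floor_eq_iff[symmetric] by auto
  also have "\<dots> \<longleftrightarrow> x \<in> cell G j"
    using w by (auto simp: cell_def iface_def field_simps)
  finally show ?thesis by simp
qed

lemma cell_index_period:
  "grid_ok G \<Longrightarrow> cell_index G (x + (hi G - lo G)) = cell_index G x + int (ncells G)"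
  using mem_cell_iff[of G] cell_period[of G "x + (hi G - lo G)" "cell_index G x"] by auto

lemma cell_index_domain:
  assumes "grid_ok G" "x \<in> {lo G..<hi G}"
  shows "cell_index G x \<in> {1..int (ncells G)}"
proof -
  have w: "width G > 0" by (rule width_pos[OF assms(1)])
  have "0 \<le> (x - lo G) / width G" using assms w by auto
  hence "0 \<le> \<lfloor>(x - lo G) / width G\<rfloor>" by simp
  moreover have "(x - lo G) / width G < real (ncells G)"
    using assms w ncells_width[OF assms(1)] by (auto simp: field_simps)
  hence "\<lfloor>(x - lo G) / width G\<rfloor> < int (ncells G)" by (simp add: floor_less_iff)
  ultimately show ?thesis by (auto simp: cell_index_def)
qed

text \<open>Stated over a ring so that it serves both real translations of the line and integer
  shifts of cell indices.\<close>

lemma period_of_int: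
  fixes h :: "'a::ring_1 \<Rightarrow> 'b"
  assumes "\<And>x. h (x + L) = h x"
  shows "h (x + of_int t * L) = h x"
proof -
  have nat: "h (x + of_nat n * L) = h x" for x n
  proof (induction n)
    case (Suc n)
    have "h (x + of_nat (Suc n) * L) = h ((x + of_nat n * L) + L)" by (simp add: algebra_simps)
    with Suc assms show ?case by simp
  qed simp
  show ?thesis
  proof (cases "t \<ge> 0")
    case True
    then show ?thesis using nat[of x "nat t"] by simp
  next
    case False
    \<comment> \<open>For negative \<open>t\<close>, moving \<open>- t\<close> periods forward from
      the shifted point returns to \<open>x\<close>.\<close>
    then show ?thesis using nat[of "x + of_int t * L" "nat (- t)"] by (simp add: algebra_simps)
  qed
qed

lemma integral_period:
  fixes g :: "real \<Rightarrow> real"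
  assumes "\<And>x. g (x + L) = g x"
  shows "integral {a + L..b + L} g = integral {a..b} g"
  using integral_shift_Icc_real[of a b g L] assms by (simp add: o_def add.commute)

text \<open>Split \<open>{a..b + L}\<close> at \<open>b\<close> and at \<open>a + L\<close>. The
  pieces \<open>{a..b}\<close> and \<open>{a + L..b + L}\<close> are translates by one period and
  cancel.\<close>

lemma integral_period_window_aux:
  fixes g :: "real \<Rightarrow> real"
  assumes "\<And>x. g (x + L) = g x" "\<And>a b. g integrable_on {a..b}" "L \<ge> 0" "a \<le> b"
  shows "integral {a..a + L} g = integral {b..b + L} g"
proof -
  have "integral {a..b} g + integral {b..b + L} g = integral {a..b + L} g"
    by (rule Henstock_Kurzweil_Integration.integral_combine) (use assms in auto)
  moreover have "integral {a..a + L} g + integral {a + L..b + L} g = integral {a..b + L} g"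
    by (rule Henstock_Kurzweil_Integration.integral_combine) (use assms in auto)
  ultimately show ?thesis using integral_period[of g L a b, OF assms(1)] by simp
qed

lemma integral_period_window:
  fixes g :: "real \<Rightarrow> real"
  assumes "\<And>x. g (x + L) = g x" "\<And>a b. g integrable_on {a..b}" "L \<ge> 0"
  shows "integral {a..a + L} g = integral {b..b + L} g"
  using integral_period_window_aux[of g L a b, OF assms] integral_period_window_aux[of g L b a, OF assms]
  by linarith

text \<open>A common shift \<open>s\<close> keeps the cells adjacent, so the upstream cells of one
  transport line tile a shifted copy of the domain; \<open>s = 0\<close> is the mesh itself.\<close>

lemma integral_sum_cells:
  fixes g :: "real \<Rightarrow> real"
  assumes G: "grid_ok G" and g: "\<And>a b. g integrable_on {a..b}"
  shows "(\<Sum>j\<in>{1..int (ncells G)}. integral {iface G (j - 1) - s..iface G j - s} g) =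
         integral {lo G - s..hi G - s} g"
proof -
  have "(\<Sum>j\<in>{1..int n}. integral {iface G (j - 1) - s..iface G j - s} g) =
         integral {lo G - s..iface G (int n) - s} g" for n
  proof (induction n)
    case (Suc n)
    have eq: "{1..int (Suc n)} = insert (int (Suc n)) {1..int n}" by auto
    have "lo G \<le> iface G (int n)" using width_pos[OF G] by (simp add: iface_def)
    moreover have "iface G (int n) \<le> iface G (int (Suc n))"
      using iface_less[OF G, of "int (Suc n)"] by simp
    ultimately have "integral {lo G - s..iface G (int n) - s} g +
        integral {iface G (int n) - s..iface G (int (Suc n)) - s} g =
        integral {lo G - s..iface G (int (Suc n)) - s} g"
      by (intro Henstock_Kurzweil_Integration.integral_combine g) auto
    thus ?case unfolding eq by (subst sum.insert) (use Suc in auto)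
  qed simp
  from this[of "ncells G"] show ?thesis using iface_ncells[OF G] by simp
qed

section \<open>The discontinuous Galerkin spaces\<close>

lemma DG_period: "g \<in> DG k G \<Longrightarrow> g (x + (hi G - lo G)) = g x"
  by (auto simp: DG_def)

text \<open>The space prescribes polynomials only on the cells of the domain; periodicity carries
  them to every cell of the extended mesh.\<close>

lemma DG_cell:
  assumes G: "grid_ok G" and g: "g \<in> DG k G"
  obtains p where "degree p \<le> k" "\<And>x. x \<in> cell G j \<Longrightarrow> g x = poly p x"
proof -
  define n where "n = int (ncells G)"
  have n: "n > 0" using G by (auto simp: n_def grid_ok_def)
  \<comment> \<open>Cells are numbered from 1, hence the shift by one around \<open>mod\<close>:
    \<open>r\<close> is the matching cell of the domain and \<open>t\<close> the number of periods
    between the two.\<close>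
  define r t where "r = (j - 1) mod n + 1" and "t = (j - 1) div n"
  have j: "j = r + t * n" by (simp add: r_def t_def)
  have "r \<in> {1..n}" using pos_mod_bound[OF n, of "j - 1"] pos_mod_sign[OF n, of "j - 1"] unfolding r_def by simp
  hence "\<exists>p. degree p \<le> k \<and> (\<forall>x\<in>cell G r. g x = poly p x)"
    using g unfolding DG_def n_def by auto
  then obtain p where p: "degree p \<le> k" "\<And>x. x \<in> cell G r \<Longrightarrow> g x = poly p x"
    by blast
  let ?c = "of_int (- t) * (hi G - lo G)"
  let ?q = "p \<circ>\<^sub>p [:?c, 1:]"
  show thesis
  proof
    show "degree ?q \<le> k" using p(1) by (simp add: degree_pcompose)
    fix x assume "x \<in> cell G j"
    hence "x + ?c \<in> cell G r"
      using ncells_width[OF G, symmetric] unfolding j n_def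
      by (auto simp: cell_def iface_def algebra_simps)
    moreover have "g (x + ?c) = g x"
      using DG_period[OF g] by (rule period_of_int)
    ultimately show "g x = poly ?q x" using p(2) by (simp add: poly_pcompose algebra_simps)
  qed
qed

text \<open>Integrability holds on each closed cell, then on runs of consecutive cells, and is
  finally restricted from a run that covers \<open>{a..b}\<close>.\<close>

lemma DG_integrable:
  assumes G: "grid_ok G" and g: "g \<in> DG k G"
  shows "g integrable_on {a..b}"
proof -
  have cell: "g integrable_on {iface G (j - 1)..iface G j}" for j
  proof -
    obtain p where p: "\<And>x. x \<in> cell G j \<Longrightarrow> g x = poly p x" using DG_cell[OF assms] by blast
    show ?thesis
      \<comment> \<open>The right interface belongs to the next cell, so \<open>g\<close> may differ
        from the polynomial at that single point.\<close>
      by (rule integrable_spike_finite[of "{iface G j}" _ _ "poly p"])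
        (auto simp: p cell_def intro!: integrable_continuous_interval continuous_intros)
  qed
  have pos: "width G > 0" by (rule width_pos[OF G])
  have grow: "g integrable_on {iface G i..iface G (i + int n)}" for i n
  proof (induction n)
    case (Suc n)
    show ?case
      by (rule Henstock_Kurzweil_Integration.integrable_combine[OF _ _ Suc])
        (use pos cell[of "i + int (Suc n)"] in \<open>auto simp: iface_def mult_right_mono\<close>)
  qed (use integrable_on_refl[of g "iface G i"] in simp)
  define i where "i = cell_index G a - 1"
  define l where "l = cell_index G b"
  have ia: "iface G i \<le> a" using mem_cell_iff[OF G, of a "cell_index G a"] by (auto simp: cell_def i_def)
  have lb: "b \<le> iface G l" using mem_cell_iff[OF G, of b "cell_index G b"] by (auto simp: cell_def l_def)
  show ?thesis
  proof (cases "a \<le> b")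
    case True
    have "i \<le> l"
    proof (rule ccontr)
      assume "\<not> i \<le> l"
      hence "iface G l < iface G i" using pos by (simp add: iface_def)
      thus False using ia lb True by linarith
    qed
    hence "g integrable_on {iface G i..iface G l}" using grow[of i "nat (l - i)"] by simp
    thus ?thesis by (rule integrable_on_subinterval) (use ia lb in auto)
  qed (simp add: integrable_on_empty)
qed

lemma DG_const: "(\<lambda>_. c) \<in> DG k G"
  by (auto simp: DG_def intro!: bexI exI[of _ "[:c:]"])

lemma DG_add:
  assumes "f \<in> DG k G" "g \<in> DG k G"
  shows "(\<lambda>x. f x + g x) \<in> DG k G"
proof -
  have "\<exists>r. degree r \<le> k \<and> (\<forall>x\<in>cell G j. f x + g x = poly r x)" if j: "j \<in> {1..int (ncells G)}" for j
  proof -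
    obtain p q where "degree p \<le> k" "\<forall>x\<in>cell G j. f x = poly p x"
      "degree q \<le> k" "\<forall>x\<in>cell G j. g x = poly q x"
      using assms j unfolding DG_def by blast
    thus ?thesis by (intro exI[of _ "p + q"]) (auto intro: degree_add_le)
  qed
  thus ?thesis using assms by (auto simp: DG_def)
qed

lemma DG_cmult:
  assumes "f \<in> DG k G"
  shows "(\<lambda>x. c * f x) \<in> DG k G"
proof -
  have "\<exists>r. degree r \<le> k \<and> (\<forall>x\<in>cell G j. c * f x = poly r x)" if j: "j \<in> {1..int (ncells G)}" for j
  proof -
    obtain p where "degree p \<le> k" "\<forall>x\<in>cell G j. f x = poly p x"
      using assms j unfolding DG_def by blast
    thus ?thesis by (intro exI[of _ "smult c p"]) (auto intro: order_trans[OF degree_smult_le])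
  qed
  thus ?thesis using assms by (auto simp: DG_def)
qed

lemma DG_sum:
  assumes "\<And>m. m \<in> I \<Longrightarrow> f m \<in> DG k G"
  shows "(\<lambda>x. \<Sum>m\<in>I. f m x) \<in> DG k G"
  using assms
proof (induction I rule: infinite_finite_induct)
  case (insert m I)
  then show ?case using DG_add[of "f m" k G "\<lambda>x. \<Sum>m\<in>I. f m x"] by simp
qed (auto intro: DG_const)

text \<open>Unisolvence on each cell: polynomials of degree at most \<open>k\<close> that agree at
  \<open>k + 1\<close> distinct points coincide. The domain is half-open because \<open>hi G\<close>
  already lies in the next cell.\<close>

lemma DG_eq_of_gauss:
  assumes G: "grid_ok G" and f: "f \<in> DG k G" and g: "g \<in> DG k G"
    and eq: "\<And>i p. i \<in> {1..int (ncells G)} \<Longrightarrow> p \<in> {1..k+1} \<Longrightarrow>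
       f (gauss_point G k i p) = g (gauss_point G k i p)"
    and x: "x \<in> {lo G..<hi G}"
  shows "f x = g x"
proof -
  define i where "i = cell_index G x"
  have i: "i \<in> {1..int (ncells G)}" using cell_index_domain[OF G x] by (simp add: i_def)
  have xi: "x \<in> cell G i" using mem_cell_iff[OF G] by (simp add: i_def)
  obtain p where p: "degree p \<le> k" "\<And>x. x \<in> cell G i \<Longrightarrow> f x = poly p x" using DG_cell[OF G f] by blast
  obtain q where q: "degree q \<le> k" "\<And>x. x \<in> cell G i \<Longrightarrow> g x = poly q x" using DG_cell[OF G g] by blast
  have w: "width G > 0" by (rule width_pos[OF G])
  \<comment> \<open>The affine map from the reference interval is increasing, so interior nodes land
    inside the cell, where both functions are given by their polynomials.\<close>
  have in_cell: "gauss_point G k i r \<in> cell G i" if r: "r \<in> {1..k+1}" for r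
  proof -
    have "width G * gauss_node k r < width G * 1" "width G * (- 1) < width G * gauss_node k r"
      using gauss_node_bounds[OF r] w by (auto simp only: mult_less_cancel_left_pos greaterThanLessThan_iff)
    thus ?thesis using iface_diff[of G i] by (auto simp: gauss_point_def cell_def field_simps)
  qed
  have inj: "inj_on (gauss_point G k i) {1..k+1}"
    using w inj_on_gauss_node[of k] by (auto simp: inj_on_def gauss_point_def)
  have "p = q"
  proof (rule poly_eqI_degree)
    show "card (gauss_point G k i ` {1..k+1}) > degree p" "card (gauss_point G k i ` {1..k+1}) > degree q"
      using p(1) q(1) card_image[OF inj] by simp_all
    fix y assume "y \<in> gauss_point G k i ` {1..k+1}"
    then obtain r where r: "r \<in> {1..k+1}" "y = gauss_point G k i r" by blast
    show "poly p y = poly q y" using eq[OF i r(1)] in_cell[OF r(1)] p(2) q(2) r(2) by simp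
  qed
  thus ?thesis using p(2) q(2) xi by simp
qed

text \<open>Frees the sums from the index set of initial naturals; the limiter is later written as a
  sum over triples.\<close>

lemma DG2_I:
  assumes "finite I" "\<And>m. m \<in> I \<Longrightarrow> a m \<in> DG k X" "\<And>m. m \<in> I \<Longrightarrow> b m \<in> DG k V"
  shows "(\<lambda>x v. \<Sum>m\<in>I. a m x * b m v) \<in> DG2 k X V"
proof -
  obtain e where e: "bij_betw e {0..<card I} I" using ex_bij_betw_nat_finite[OF assms(1)] by blast
  have mem: "e m \<in> I" if "m < card I" for m using e that by (auto simp: bij_betw_def)
  have "(\<Sum>m\<in>I. a m x * b m v) = (\<Sum>m<card I. a (e m) x * b (e m) v)" for x v
    using sum.reindex_bij_betw[OF e, of "\<lambda>m. a m x * b m v"] by (simp add: lessThan_atLeast0)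
  thus ?thesis unfolding DG2_def mem_Collect_eq using mem assms(2,3)
    by (intro exI[of _ "card I"] exI[of _ "\<lambda>m. a (e m)"] exI[of _ "\<lambda>m. b (e m)"]) auto
qed

text \<open>Allows what is proved for the first variable to be transferred to the second.\<close>

lemma DG2_flip:
  assumes "f \<in> DG2 k X V"
  shows "(\<lambda>v x. f x v) \<in> DG2 k V X"
proof -
  obtain n :: nat and a b where "\<forall>m<n. a m \<in> DG k X \<and> b m \<in> DG k V"
    and f_eq: "f = (\<lambda>x v. \<Sum>m<n. a m x * b m v)" using assms unfolding DG2_def by blast
  hence ab: "\<And>m. m < n \<Longrightarrow> a m \<in> DG k X" "\<And>m. m < n \<Longrightarrow> b m \<in> DG k V" by auto
  have "(\<lambda>v x. \<Sum>m<n. b m v * a m x) \<in> DG2 k V X" by (rule DG2_I) (use ab in auto)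
  thus ?thesis by (simp add: f_eq mult.commute)
qed

lemma DG2_slice:
  assumes "f \<in> DG2 k X V"
  shows "(\<lambda>x. f x v) \<in> DG k X"
proof -
  obtain n :: nat and a b where "\<forall>m<n. a m \<in> DG k X \<and> b m \<in> DG k V"
    and f_eq: "f = (\<lambda>x v. \<Sum>m<n. a m x * b m v)" using assms unfolding DG2_def by blast
  hence ab: "\<And>m. m < n \<Longrightarrow> a m \<in> DG k X" "\<And>m. m < n \<Longrightarrow> b m \<in> DG k V" by auto
  have "(\<lambda>x. \<Sum>m<n. b m v * a m x) \<in> DG k X" by (intro DG_sum DG_cmult) (use ab in auto)
  thus ?thesis by (simp add: f_eq mult.commute)
qed

text \<open>Integrating out \<open>x\<close> turns each first factor into a number, leaving a linear
  combination of the second factors. This makes line integrals accessible to unisolvence.\<close>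

lemma DG2_integral:
  assumes X: "grid_ok X" and f: "f \<in> DG2 k X V"
  shows "(\<lambda>v. integral {c..d} (\<lambda>x. f x v)) \<in> DG k V"
proof -
  obtain n :: nat and a b where "\<forall>m<n. a m \<in> DG k X \<and> b m \<in> DG k V"
    and f_eq: "f = (\<lambda>x v. \<Sum>m<n. a m x * b m v)" using f unfolding DG2_def by blast
  hence ab: "\<And>m. m < n \<Longrightarrow> a m \<in> DG k X" "\<And>m. m < n \<Longrightarrow> b m \<in> DG k V" by auto
  have "integral {c..d} (\<lambda>x. f x v) = (\<Sum>m<n. integral {c..d} (a m) * b m v)" for v
    unfolding f_eq
    by (subst Henstock_Kurzweil_Integration.integral_sum) (auto intro: integrable_on_mult_left[OF DG_integrable[OF X ab(1)]])
  moreover have "(\<lambda>v. \<Sum>m<n. integral {c..d} (a m) * b m v) \<in> DG k V"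
    by (intro DG_sum DG_cmult) (use ab in auto)
  ultimately show ?thesis by simp
qed

text \<open>For finite sums of products both iterated integrals reduce to the same sum of products
  of one-dimensional integrals.\<close>

lemma DG2_fubini:
  assumes X: "grid_ok X" and V: "grid_ok V" and f: "f \<in> DG2 k X V"
  shows "integral {c..d} (\<lambda>v. integral {c'..d'} (\<lambda>x. f x v)) =
         integral {c'..d'} (\<lambda>x. integral {c..d} (\<lambda>v. f x v))"
proof -
  obtain n :: nat and a b where "\<forall>m<n. a m \<in> DG k X \<and> b m \<in> DG k V"
    and f_eq: "f = (\<lambda>x v. \<Sum>m<n. a m x * b m v)" using f unfolding DG2_def by blast
  hence ab: "\<And>m. m < n \<Longrightarrow> a m \<in> DG k X" "\<And>m. m < n \<Longrightarrow> b m \<in> DG k V" by auto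
  have "integral {c'..d'} (\<lambda>x. f x v) = (\<Sum>m<n. integral {c'..d'} (a m) * b m v)" for v
    unfolding f_eq
    by (subst Henstock_Kurzweil_Integration.integral_sum) (auto intro: integrable_on_mult_left[OF DG_integrable[OF X ab(1)]])
  hence 1: "integral {c..d} (\<lambda>v. integral {c'..d'} (\<lambda>x. f x v)) =
      (\<Sum>m<n. integral {c'..d'} (a m) * integral {c..d} (b m))"
    by (simp, subst Henstock_Kurzweil_Integration.integral_sum) (auto intro: integrable_on_mult_right[OF DG_integrable[OF V ab(2)]])
  have "integral {c..d} (\<lambda>v. f x v) = (\<Sum>m<n. a m x * integral {c..d} (b m))" for x
    unfolding f_eq
    by (subst Henstock_Kurzweil_Integration.integral_sum) (auto intro: integrable_on_mult_right[OF DG_integrable[OF V ab(2)]])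
  hence "integral {c'..d'} (\<lambda>x. integral {c..d} (\<lambda>v. f x v)) =
      (\<Sum>m<n. integral {c'..d'} (a m) * integral {c..d} (b m))"
    by (simp, subst Henstock_Kurzweil_Integration.integral_sum) (auto intro: integrable_on_mult_left[OF DG_integrable[OF X ab(1)]])
  with 1 show ?thesis by simp
qed

lemma mass_flip:
  assumes "grid_ok X" "grid_ok V" "f \<in> DG2 k X V"
  shows "mass V X (\<lambda>v x. f x v) = mass X V f"
  unfolding mass_def using DG2_fubini[OF assms] by simp

section \<open>The two transport updates\<close>

text \<open>Common core of both updates. The shift may depend on the Gauss line but not on the cell
  \<open>j\<close>, so summing over \<open>j\<close> integrates \<open>f\<close> over one full,
  shifted period.\<close>

lemma mass_transport:
  assumes X: "grid_ok X" and V: "grid_ok V" and f: "f \<in> DG2 k X V" and g: "g \<in> DG2 k X V"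
    and upd: "\<And>i p j. i \<in> {1..int (ncells V)} \<Longrightarrow> p \<in> {1..k+1} \<Longrightarrow> j \<in> {1..int (ncells X)} \<Longrightarrow>
       integral {iface X (j - 1)..iface X j} (\<lambda>x. g x (gauss_point V k i p)) =
       integral {iface X (j - 1) - s i p..iface X j - s i p} (\<lambda>x. f x (gauss_point V k i p))"
  shows "mass X V g = mass X V f"
proof -
  let ?F = "\<lambda>v. integral {lo X..hi X} (\<lambda>x. f x v)" and ?G = "\<lambda>v. integral {lo X..hi X} (\<lambda>x. g x v)"
  have "?G (gauss_point V k i p) = ?F (gauss_point V k i p)"
    if ip: "i \<in> {1..int (ncells V)}" "p \<in> {1..k+1}" for i p
  proof -
    let ?v = "gauss_point V k i p"
    have fs: "(\<lambda>x. f x ?v) \<in> DG k X" and gs: "(\<lambda>x. g x ?v) \<in> DG k X" using DG2_slice f g by blast+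
    have "?G ?v = (\<Sum>j\<in>{1..int (ncells X)}. integral {iface X (j - 1)..iface X j} (\<lambda>x. g x ?v))"
      using integral_sum_cells[OF X DG_integrable[OF X gs], of 0] by simp
    also have "\<dots> = integral {lo X - s i p..hi X - s i p} (\<lambda>x. f x ?v)"
      using integral_sum_cells[OF X DG_integrable[OF X fs], of "s i p"] upd[OF ip] by simp
    also have "\<dots> = ?F ?v"
      using integral_period_window[of "\<lambda>x. f x ?v", OF DG_period[OF fs] DG_integrable[OF X fs], of "lo X - s i p" "lo X"] X
      by (auto simp: grid_ok_def algebra_simps)
    finally show ?thesis .
  qed
  hence eq: "?G v = ?F v" if "v \<in> {lo V..<hi V}" for v
    using DG_eq_of_gauss[OF V DG2_integral[OF X g] DG2_integral[OF X f] _ that] by blast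
  show ?thesis unfolding mass_def
    \<comment> \<open>The two line integrals are known to agree on the half-open domain; the
      remaining endpoint is a null set.\<close>
    by (rule integral_spike[of "{hi V}"]) (auto simp: eq)
qed

lemma is_Sf_mass:
  assumes "grid_ok X" "grid_ok V" "f \<in> DG2 k X V" "is_Sf X V k dt f g"
  shows "mass X V g = mass X V f"
proof (rule mass_transport)
  fix i p j
  assume "i \<in> {1..int (ncells V)}" "p \<in> {1..k+1}" "j \<in> {1..int (ncells X)}"
  thus "integral {iface X (j - 1)..iface X j} (\<lambda>x. g x (gauss_point V k i p)) =
      integral {iface X (j - 1) - gauss_point V k i p * dt..iface X j - gauss_point V k i p * dt}
        (\<lambda>x. f x (gauss_point V k i p))"
    \<comment> \<open>The test function is the constant 1, whose translate along the characteristic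
      is again 1.\<close>
    using assms(4) DG_const[of 1 k X] unfolding is_Sf_def Let_def by fastforce
qed (use assms is_Sf_def in auto)

text \<open>The same transport argument with \<open>x\<close> and \<open>v\<close> exchanged: on
  each Gauss line in \<open>x\<close> the shift \<open>E j q * dt\<close> is constant along
  \<open>v\<close>.\<close>

lemma is_SE_mass:
  assumes "grid_ok X" "grid_ok V" "f \<in> DG2 k X V" "is_SE X V k dt E f g"
  shows "mass X V g = mass X V f"
proof -
  have g: "g \<in> DG2 k X V" using assms(4) by (simp add: is_SE_def)
  have "mass V X (\<lambda>v x. g x v) = mass V X (\<lambda>v x. f x v)"
  proof (rule mass_transport[OF assms(2,1) DG2_flip[OF assms(3)] DG2_flip[OF g]])
    fix j q i
    assume "j \<in> {1..int (ncells X)}" "q \<in> {1..k+1}" "i \<in> {1..int (ncells V)}"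
    thus "integral {iface V (i - 1)..iface V i} (\<lambda>v. g (gauss_point X k j q) v) =
        integral {iface V (i - 1) - E j q * dt..iface V i - E j q * dt}
          (\<lambda>v. f (gauss_point X k j q) v)"
      using assms(4) DG_const[of 1 k V] unfolding is_SE_def Let_def by fastforce
  qed
  thus ?thesis using mass_flip[OF assms(1,2)] assms(3) g by simp
qed

section \<open>The limiter\<close>

lemma cell_average_period_x:
  assumes "grid_ok X" "f \<in> DG2 k X V"
  shows "cell_average X V f (j + int (ncells X)) i = cell_average X V f j i"
proof -
  have "integral {iface X (j + int (ncells X) - 1)..iface X (j + int (ncells X))} (\<lambda>x. f x v) =
      integral {iface X (j - 1)..iface X j} (\<lambda>x. f x v)" for v
  proof -
    have "j + int (ncells X) - 1 = (j - 1) + int (ncells X)" by simp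
    thus ?thesis
      using integral_period[of "\<lambda>x. f x v", OF DG_period[OF DG2_slice[OF assms(2)]]]
      by (simp only: iface_period[OF assms(1)])
  qed
  thus ?thesis by (simp add: cell_average_def)
qed

lemma cell_average_flip:
  assumes "grid_ok X" "grid_ok V" "f \<in> DG2 k X V"
  shows "cell_average V X (\<lambda>v x. f x v) i j = cell_average X V f j i"
  unfolding cell_average_def using DG2_fubini[OF assms] by (simp add: mult.commute)

lemma cell_image_flip:
  "(\<lambda>(v, x). f x v) ` (cell V i \<times> cell X j) = (\<lambda>(x, v). f x v) ` (cell X j \<times> cell V i)"
  by auto

lemma cell_image_period_x:
  assumes "grid_ok X" "f \<in> DG2 k X V"
  shows "(\<lambda>(x, v). f x v) ` (cell X (j + int (ncells X)) \<times> cell V i) =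
         (\<lambda>(x, v). f x v) ` (cell X j \<times> cell V i)"
proof -
  have "cell X (j + int (ncells X)) = (\<lambda>x. x + (hi X - lo X)) ` cell X j"
  proof (rule set_eqI)
    fix x
    have "x \<in> (\<lambda>x. x + (hi X - lo X)) ` cell X j \<longleftrightarrow> x - (hi X - lo X) \<in> cell X j"
      by (auto intro: image_eqI[of _ _ "x - (hi X - lo X)"])
    thus "x \<in> cell X (j + int (ncells X)) \<longleftrightarrow> x \<in> (\<lambda>x. x + (hi X - lo X)) ` cell X j"
      using cell_period[OF assms(1)] by simp
  qed
  moreover have "f (x + (hi X - lo X)) = f x" for x
    using DG_period[OF DG2_slice[OF assms(2)]] by (rule ext)
  moreover have "(\<lambda>(x, v). f x v) ` (A \<times> B) = (\<Union>x\<in>A. f x ` B)" for A B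
    by auto
  ultimately show ?thesis by simp
qed

text \<open>The scaling factor depends on \<open>f\<close> only through its set of values on the
  cell and its cell average, so it inherits every symmetry of these two.\<close>

lemma limiter_theta_alt:
  "limiter_theta X V f j i =
     (let S = (\<lambda>(x, v). f x v) ` (cell X j \<times> cell V i); m = cell_average X V f j i in
      if \<exists>c. S \<subseteq> {c} then 1 else min \<bar>(1 / 10 ^ 15 - m) / (Inf S - m)\<bar> 1)"
  unfolding limiter_theta_def Let_def cell_min_def constant_on_def
  by (simp add: image_subset_iff)

lemma limiter_theta_period_x:
  assumes "grid_ok X" "f \<in> DG2 k X V"
  shows "limiter_theta X V f (j + int (ncells X)) i = limiter_theta X V f j i"
  unfolding limiter_theta_alt cell_image_period_x[OF assms] cell_average_period_x[OF assms] ..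

lemma limiter_theta_flip:
  assumes "grid_ok X" "grid_ok V" "f \<in> DG2 k X V"
  shows "limiter_theta V X (\<lambda>v x. f x v) i j = limiter_theta X V f j i"
  unfolding limiter_theta_alt cell_image_flip[of f V i X j] cell_average_flip[OF assms] ..

text \<open>The index of the cell of the domain onto which a cell of the periodic mesh is translated.\<close>

definition cell_rep :: "grid \<Rightarrow> int \<Rightarrow> int" where
  "cell_rep G j = (j - 1) mod int (ncells G) + 1"

lemma cell_rep_mem: "grid_ok G \<Longrightarrow> cell_rep G j \<in> {1..int (ncells G)}"
  using pos_mod_bound[of "int (ncells G)" "j - 1"] pos_mod_sign[of "int (ncells G)" "j - 1"]
  by (simp add: cell_rep_def grid_ok_def zless_imp_add1_zle)

lemma cell_rep_period: "cell_rep G (j + int (ncells G)) = cell_rep G j"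
  unfolding cell_rep_def by (metis add_diff_eq add.commute mod_add_self1)

lemma cell_rep_invariant:
  assumes "\<And>j. h (j + int (ncells G)) = h j"
  shows "h (cell_rep G j) = h j"
proof -
  have "j = cell_rep G j + of_int ((j - 1) div int (ncells G)) * int (ncells G)"
    by (simp add: cell_rep_def)
  thus ?thesis using period_of_int[of h, OF assms] by metis
qed

text \<open>On each cell the product is either the old polynomial or 0; using the representative of
  the cell index makes the indicator periodic.\<close>

lemma DG_cell_indicator:
  assumes "grid_ok G" "g \<in> DG k G"
  shows "(\<lambda>x. of_bool (cell_rep G (cell_index G x) = r) * g x) \<in> DG k G"
proof -
  have "\<exists>p. degree p \<le> k \<and> (\<forall>x\<in>cell G j. of_bool (cell_rep G (cell_index G x) = r) * g x = poly p x)" for j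
  proof -
    obtain p where "degree p \<le> k" "\<And>x. x \<in> cell G j \<Longrightarrow> g x = poly p x" using DG_cell[OF assms] by blast
    thus ?thesis
      by (intro exI[of _ "if cell_rep G j = r then p else 0"]) (auto simp: mem_cell_iff[OF assms(1)])
  qed
  thus ?thesis
    using DG_period[OF assms(2)] by (auto simp: DG_def cell_index_period[OF assms(1)] cell_rep_period)
qed

text \<open>On a cell the limited function is \<open>\<theta> f + (1 - \<theta>) m\<close>, with
  \<open>\<theta>\<close> the scaling factor and \<open>m\<close> the cell average. Both are
  periodic in the cell indices, so finitely many indicators of domain cells suffice, and an
  indicator of a rectangle is itself a product.\<close>

lemma limiter_DG2:
  assumes X: "grid_ok X" and V: "grid_ok V" and f: "f \<in> DG2 k X V"
  shows "limiter X V f \<in> DG2 k X V"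
proof -
  obtain n :: nat and a b where "\<forall>m<n. a m \<in> DG k X \<and> b m \<in> DG k V"
    and f_eq: "f = (\<lambda>x v. \<Sum>m<n. a m x * b m v)" using f unfolding DG2_def by blast
  hence ab: "\<And>m. m < n \<Longrightarrow> a m \<in> DG k X" "\<And>m. m < n \<Longrightarrow> b m \<in> DG k V" by auto
  let ?th = "limiter_theta X V f" and ?av = "cell_average X V f"
  let ?JX = "{1..int (ncells X)}" and ?JV = "{1..int (ncells V)}"
  let ?IX = "\<lambda>j x. of_bool (cell_rep X (cell_index X x) = j) :: real"
  let ?IV = "\<lambda>i v. of_bool (cell_rep V (cell_index V v) = i) :: real"
  \<comment> \<open>The indices \<open>m < n\<close> carry the summands of \<open>f\<close> scaled
    by the factor; the extra index \<open>n\<close> carries the constant contribution of the average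
    as \<open>1 * 1\<close>.\<close>
  define c where "c m j i = (if m < n then ?th j i else (1 - ?th j i) * ?av j i)" for m j i
  define a' where "a' m = (if m < n then a m else (\<lambda>_. 1))" for m
  define b' where "b' m = (if m < n then b m else (\<lambda>_. 1))" for m
  \<comment> \<open>Reduce the first index directly and the second through the flipped
    function.\<close>
  have th: "?th (cell_rep X j) (cell_rep V i) = ?th j i"
    and av: "?av (cell_rep X j) (cell_rep V i) = ?av j i" for j i
  proof -
    have ff: "(\<lambda>v x. f x v) \<in> DG2 k V X" by (rule DG2_flip[OF f])
    show "?th (cell_rep X j) (cell_rep V i) = ?th j i"
      using cell_rep_invariant[of "\<lambda>j. ?th j (cell_rep V i)" X j, OF limiter_theta_period_x[OF X f]]
        cell_rep_invariant[of "\<lambda>i. ?th j i" V i] limiter_theta_period_x[OF V ff]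
        limiter_theta_flip[OF X V f] by simp
    show "?av (cell_rep X j) (cell_rep V i) = ?av j i"
      using cell_rep_invariant[of "\<lambda>j. ?av j (cell_rep V i)" X j, OF cell_average_period_x[OF X f]]
        cell_rep_invariant[of "\<lambda>i. ?av j i" V i] cell_average_period_x[OF V ff]
        cell_average_flip[OF X V f] by simp
  qed
  let ?I = "{..n} \<times> ?JX \<times> ?JV"
  have mem: "(\<lambda>x v. \<Sum>t\<in>?I. (case t of (m, j, i) \<Rightarrow> c m j i * (?IX j x * a' m x)) *
      (case t of (m, j, i) \<Rightarrow> ?IV i v * b' m v)) \<in> DG2 k X V"
    (is "?S \<in> _")
  proof (rule DG2_I)
    fix t assume "t \<in> ?I"
    then obtain m j i where t: "t = (m, j, i)" by (cases t) auto
    have "a' m \<in> DG k X" "b' m \<in> DG k V" using ab DG_const by (auto simp: a'_def b'_def)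
    thus "(\<lambda>x. case t of (m, j, i) \<Rightarrow> c m j i * (?IX j x * a' m x)) \<in> DG k X"
      "(\<lambda>v. case t of (m, j, i) \<Rightarrow> ?IV i v * b' m v) \<in> DG k V"
      unfolding t using DG_cell_indicator[OF X] DG_cell_indicator[OF V] by (auto intro!: DG_cmult)
  qed simp
  have S_eq: "?S x v = limiter X V f x v" for x v
  proof -
    \<comment> \<open>Only the pair \<open>J\<close>, \<open>I\<close> has both indicators equal to
      1 at the given point, which collapses the sums over cells.\<close>
    define J I where "J = cell_rep X (cell_index X x)" and "I = cell_rep V (cell_index V v)"
    have JI: "J \<in> ?JX" "I \<in> ?JV" using cell_rep_mem X V by (auto simp: J_def I_def)
    have "?S x v = (\<Sum>m\<le>n. \<Sum>j\<in>?JX. \<Sum>i\<in>?JV. c m j i * (?IX j x * a' m x) * (?IV i v * b' m v))"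
      by (simp add: sum.cartesian_product case_prod_unfold)
    also have "\<dots> = (\<Sum>m\<le>n. \<Sum>j\<in>?JX. \<Sum>i\<in>?JV.
        if I = i then (if J = j then c m j i * a' m x * b' m v else 0) else 0)"
      by (intro sum.cong) (auto simp: J_def I_def)
    also have "\<dots> = (\<Sum>m\<le>n. c m J I * a' m x * b' m v)"
      using JI by (simp add: sum.delta')
    also have "\<dots> = (\<Sum>m<n. ?th J I * (a m x * b m v)) + (1 - ?th J I) * ?av J I"
      by (subst lessThan_Suc_atMost[symmetric]) (simp add: c_def a'_def b'_def mult.assoc)
    also have "\<dots> = ?th J I * (f x v - ?av J I) + ?av J I"
    proof -
      have "(\<Sum>m<n. ?th J I * (a m x * b m v)) = ?th J I * (\<Sum>m<n. a m x * b m v)"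
        by (rule sum_distrib_left[symmetric])
      also have "(\<Sum>m<n. a m x * b m v) = f x v" by (simp add: f_eq)
      finally have "(\<Sum>m<n. ?th J I * (a m x * b m v)) = ?th J I * f x v" .
      thus ?thesis by argo
    qed

    also have "\<dots> = limiter X V f x v"
      by (simp add: limiter_def Let_def J_def I_def th av)
    finally show ?thesis .
  qed
  have "?S = limiter X V f" by (intro ext) (rule S_eq)
  with mem show ?thesis by (rule back_subst)
qed

text \<open>Integrating \<open>\<theta> (f - m) + m\<close> over the cell, the first term vanishes
  because \<open>m\<close> is the average, whatever the value of \<open>\<theta>\<close>.\<close>

lemma limiter_cell_integral:
  assumes X: "grid_ok X" and V: "grid_ok V" and f: "f \<in> DG2 k X V"
  shows "integral {iface V (i - 1)..iface V i}
           (\<lambda>v. integral {iface X (j - 1)..iface X j} (\<lambda>x. limiter X V f x v)) =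
         integral {iface V (i - 1)..iface V i}
           (\<lambda>v. integral {iface X (j - 1)..iface X j} (\<lambda>x. f x v))"
proof -
  let ?CX = "{iface X (j - 1)..iface X j}" and ?CV = "{iface V (i - 1)..iface V i}"
  let ?P = "\<lambda>v. integral ?CX (\<lambda>x. f x v)"
  define m t where "m = cell_average X V f j i" and "t = limiter_theta X V f j i"
  have w: "width X > 0" "width V > 0" using width_pos X V by auto
  have inner: "integral ?CX (\<lambda>x. limiter X V f x v) = t * ?P v + (1 - t) * m * width X"
    if v: "v \<in> cell V i" for v
  proof -
    have "integral ?CX (\<lambda>x. limiter X V f x v) = integral ?CX (\<lambda>x. t * f x v + (1 - t) * m)"
    \<comment> \<open>At the right interface the limiter uses the coefficients of the next cell, so
      this point is discarded.\<close>
    proof (rule integral_spike[of "{iface X j}"])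
      fix x assume "x \<in> ?CX - {iface X j}"
      hence "cell_index X x = j" using mem_cell_iff[OF X, of x j] by (auto simp: cell_def)
      moreover have "cell_index V v = i" using v mem_cell_iff[OF V] by auto
      ultimately show "t * f x v + (1 - t) * m = limiter X V f x v"
        by (simp add: limiter_def Let_def m_def t_def algebra_simps)
    qed simp
    also have "\<dots> = t * ?P v + (1 - t) * m * width X"
      using DG_integrable[OF X DG2_slice[OF f]] iface_less[OF X, of j] iface_diff[of X j]
      by (subst Henstock_Kurzweil_Integration.integral_add) (auto intro!: integrable_on_mult_right)
    finally show ?thesis .
  qed
  have "integral ?CV (\<lambda>v. integral ?CX (\<lambda>x. limiter X V f x v)) =
      integral ?CV (\<lambda>v. t * ?P v + (1 - t) * m * width X)"
    by (rule integral_spike[of "{iface V i}"]) (auto simp: inner cell_def)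
  also have "\<dots> = t * integral ?CV ?P + (1 - t) * m * width X * width V"
    using DG_integrable[OF V DG2_integral[OF X f]] iface_less[OF V, of i] iface_diff[of V i]
    by (subst Henstock_Kurzweil_Integration.integral_add) (auto intro!: integrable_on_mult_right)
  also have "m * width X * width V = integral ?CV ?P"
    using w by (simp add: m_def cell_average_def)
  hence "t * integral ?CV ?P + (1 - t) * m * width X * width V = integral ?CV ?P"
    by (simp add: algebra_simps)
  finally show ?thesis .
qed

lemma mass_sum_cells:
  assumes X: "grid_ok X" and V: "grid_ok V" and f: "f \<in> DG2 k X V"
  shows "mass X V f = (\<Sum>i\<in>{1..int (ncells V)}. \<Sum>j\<in>{1..int (ncells X)}.
     integral {iface V (i - 1)..iface V i} (\<lambda>v. integral {iface X (j - 1)..iface X j} (\<lambda>x. f x v)))"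
proof -
  have inner: "integral {lo X..hi X} (\<lambda>x. f x v) =
      (\<Sum>j\<in>{1..int (ncells X)}. integral {iface X (j - 1)..iface X j} (\<lambda>x. f x v))" for v
    using integral_sum_cells[OF X DG_integrable[OF X DG2_slice[OF f]], of 0] by simp
  have "mass X V f = (\<Sum>i\<in>{1..int (ncells V)}.
      integral {iface V (i - 1)..iface V i} (\<lambda>v. integral {lo X..hi X} (\<lambda>x. f x v)))"
    unfolding mass_def
    using integral_sum_cells[OF V DG_integrable[OF V DG2_integral[OF X f]], of 0] by simp
  also have "\<dots> = (\<Sum>i\<in>{1..int (ncells V)}. \<Sum>j\<in>{1..int (ncells X)}.
     integral {iface V (i - 1)..iface V i} (\<lambda>v. integral {iface X (j - 1)..iface X j} (\<lambda>x. f x v)))"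
    unfolding inner
    by (intro sum.cong Henstock_Kurzweil_Integration.integral_sum DG_integrable[OF V DG2_integral[OF X f]]) auto
  finally show ?thesis .
qed

text \<open>Cellwise conservation is summed over the mesh; the decomposition applies to the limited
  function because it stays in the tensor product space.\<close>

lemma limiter_mass:
  assumes "grid_ok X" "grid_ok V" "f \<in> DG2 k X V"
  shows "mass X V (limiter X V f) = mass X V f"
  unfolding mass_sum_cells[OF assms] mass_sum_cells[OF assms(1,2) limiter_DG2[OF assms]]
    limiter_cell_integral[OF assms] ..

section \<open>Conservation of mass over one full step\<close>

theorem theorem3p2:
  fixes X V :: grid and k :: nat and dt lambda :: real
    and solver :: field_solver and limited :: bool
    and f f' :: "real \<Rightarrow> real \<Rightarrow> real"
  assumes "grid_ok X" and "grid_ok V"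
    and "dt > 0"
    and "f \<in> DG2 k X V"
    and "ap_csldg1_step limited solver lambda X V k dt f f'"
  shows "mass X V f' = mass X V f"
proof -
  define post where "post = (if limited then limiter X V else id)"
  obtain g h where g: "is_Sf X V k dt f g"
    and h: "is_SE X V k dt (efield solver lambda X V k dt f) (post g) h" and f': "f' = post h"
    using assms(5) unfolding ap_csldg1_step_def post_def Let_def by blast
  \<comment> \<open>Covers the limited and the bare scheme at once: the identity trivially shares
    both properties of the limiter.\<close>
  have post: "post u \<in> DG2 k X V" "mass X V (post u) = mass X V u" if "u \<in> DG2 k X V" for u
    using limiter_DG2 limiter_mass assms(1,2) that by (auto simp: post_def)
  have gD: "g \<in> DG2 k X V" and hD: "h \<in> DG2 k X V" using g h by (auto simp: is_Sf_def is_SE_def)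
  have "mass X V f' = mass X V h" using post(2)[OF hD] f' by simp
  also have "\<dots> = mass X V (post g)" by (rule is_SE_mass[OF assms(1,2) post(1)[OF gD] h])
  also have "\<dots> = mass X V g" by (rule post(2)[OF gD])
  also have "\<dots> = mass X V f" by (rule is_Sf_mass[OF assms(1,2,4) g])
  finally show ?thesis .
qed

end
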